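(* Let $r\in\mathbb N$, let $0<\theta<1$, and let $N\in\mathbb N$ be such that $N\ge2r$ and $\frac rN<\theta$. Then $$\operatorname{Sel}_{\ell_\infty^{2^N}}(r,\theta)\ge\frac12.$$
   Context: $\ell_\infty^m$ is $\mathbb R^m$ with the maximum norm. For a Banach space $X$ with closed unit ball $\mathbf B_X$ and $0<\theta<1$, $\operatorname{Sel}_X(r,\theta)$ is the supremum over finite $P\subset X$ with $|P|\ge r$ and positive diameter of the infimum over $x\in X$ of the infimum of all $\alpha>0$ such that at least $\theta\binom{|P|}{r}$ of the $r$-element subsets $A\subset P$ satisfy $\operatorname{conv}A\cap(x+\alpha\operatorname{diam}(P)\mathbf B_X)\ne\emptyset$. *)

theory Defs
  imports "HOL-Analysis.Analysis"
begin

text \<open>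
  The library type \<^typ>\<open>real ^ 'n\<close> carries the Euclidean norm.
  The type below is a copy of it with the maximum norm, so that \<open>'n linf\<close> is
  \<open>\<ell>\<^sub>\<infinity>\<^sup>m\<close> with \<open>m = CARD('n)\<close>.
\<close>

typedef ('n::finite) linf = "UNIV :: (real ^ 'n) set"
  morphisms vec_of_linf linf_of_vec
  by simp

lemmas vec_of_linf_simps [simp] =
  vec_of_linf_inverse linf_of_vec_inverse [OF UNIV_I] vec_of_linf_inject

instantiation linf :: (finite) real_vector
begin

definition zero_linf_def: "0 = linf_of_vec 0"
definition plus_linf_def: "x + y = linf_of_vec (vec_of_linf x + vec_of_linf y)"
definition uminus_linf_def: "- x = linf_of_vec (- vec_of_linf x)"
definition minus_linf_def: "x - y = linf_of_vec (vec_of_linf x - vec_of_linf y)"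
definition scaleR_linf_def: "c *\<^sub>R x = linf_of_vec (c *\<^sub>R vec_of_linf x)"

lemma vec_of_linf_ops [simp]:
  "vec_of_linf 0 = 0"
  "vec_of_linf (x + y) = vec_of_linf x + vec_of_linf y"
  "vec_of_linf (- x) = - vec_of_linf x"
  "vec_of_linf (x - y) = vec_of_linf x - vec_of_linf y"
  "vec_of_linf (c *\<^sub>R x) = c *\<^sub>R vec_of_linf x"
  by (simp_all add: zero_linf_def plus_linf_def uminus_linf_def minus_linf_def scaleR_linf_def)

instance
  by standard (simp_all flip: vec_of_linf_inject add: algebra_simps)

end

instantiation linf :: (finite) real_normed_vector
begin

definition norm_linf_def: "norm x = infnorm (vec_of_linf x)"
definition dist_linf_def: "dist x y = norm (x - y :: 'a linf)"
definition sgn_linf_def: "sgn x = inverse (norm x) *\<^sub>R (x :: 'a linf)"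
definition uniformity_linf_def:
  "(uniformity :: ('a linf \<times> 'a linf) filter) = (INF e\<in>{0<..}. principal {(x, y). dist x y < e})"
definition open_linf_def:
  "open (U :: 'a linf set) \<longleftrightarrow> (\<forall>x\<in>U. \<forall>\<^sub>F (x', y) in uniformity. x' = x \<longrightarrow> y \<in> U)"

instance
proof
  fix x y :: "'a linf" and c :: real
  show "norm x = 0 \<longleftrightarrow> x = 0"
    by (simp add: norm_linf_def infnorm_eq_0 flip: vec_of_linf_inject)
  show "norm (x + y) \<le> norm x + norm y"
    by (simp add: norm_linf_def infnorm_triangle)
  show "norm (c *\<^sub>R x) = \<bar>c\<bar> * norm x"
    by (simp add: norm_linf_def infnorm_mul)
qed (simp_all add: dist_linf_def sgn_linf_def uniformity_linf_def open_linf_def)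

end

lemma norm_linf_eq_Max:
  "norm (x :: 'n::finite linf) = Max (range (\<lambda>i. \<bar>vec_of_linf x $ i\<bar>))"
proof -
  have "{\<bar>vec_of_linf x \<bullet> b\<bar> | b. b \<in> Basis} = range (\<lambda>i. \<bar>vec_of_linf x $ i\<bar>)"
    by (force simp: Basis_vec_def inner_axis)
  then show ?thesis
    by (simp add: norm_linf_def infnorm_def cSup_eq_Max)
qed

instance linf :: (finite) banach
proof
  fix X :: "nat \<Rightarrow> 'a linf"
  assume X: "Cauchy X"
  define K where "K = sqrt (DIM(real ^ 'a))"
  have K: "K > 0"
    by (simp add: K_def)
  have le: "norm (vec_of_linf x) \<le> K * norm x" for x :: "'a linf"
    unfolding norm_linf_def K_def by (rule norm_le_infnorm)
  have "Cauchy (\<lambda>n. vec_of_linf (X n))"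
  proof (rule CauchyI)
    fix e :: real
    assume "e > 0"
    with K have "e / K > 0"
      by simp
    then obtain M where M: "\<And>m n. m \<ge> M \<Longrightarrow> n \<ge> M \<Longrightarrow> norm (X m - X n) < e / K"
      using X CauchyD by blast
    have "norm (vec_of_linf (X m) - vec_of_linf (X n)) < e" if "m \<ge> M" "n \<ge> M" for m n
    proof -
      have "K * norm (X m - X n) < e"
        using M [OF that] K by (simp add: field_simps)
      then show ?thesis
        using le [of "X m - X n"] by simp
    qed
    then show "\<exists>M. \<forall>m\<ge>M. \<forall>n\<ge>M. norm (vec_of_linf (X m) - vec_of_linf (X n)) < e"
      by blast
  qed
  then obtain l where l: "(\<lambda>n. vec_of_linf (X n)) \<longlonglongrightarrow> l"
    using Cauchy_convergent convergent_def by blast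
  have "X \<longlonglongrightarrow> linf_of_vec l"
  proof (rule LIMSEQ_I)
    fix e :: real
    assume "e > 0"
    then obtain M where M: "\<And>n. n \<ge> M \<Longrightarrow> norm (vec_of_linf (X n) - l) < e"
      using l LIMSEQ_D by blast
    then have "norm (X n - linf_of_vec l) < e" if "n \<ge> M" for n
      using infnorm_le_norm [of "vec_of_linf (X n) - l"] M [OF that]
      by (simp add: norm_linf_def)
    then show "\<exists>M. \<forall>n\<ge>M. norm (X n - linf_of_vec l) < e"
      by blast
  qed
  then show "convergent X"
    by (auto simp: convergent_def)
qed

text \<open>
  The values are extended reals, so that an infimum over the empty set is \<open>\<infinity>\<close> and the
  supremum needs no boundedness side condition.
\<close>

definition Sel :: "'a::banach itself \<Rightarrow> nat \<Rightarrow> real \<Rightarrow> ereal" where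
  "Sel _ r \<theta> =
    (SUP P \<in> {P :: 'a set. finite P \<and> card P \<ge> r \<and> diameter P > 0}.
      INF x \<in> (UNIV :: 'a set).
        INF \<alpha> \<in> {\<alpha> :: real. \<alpha> > 0 \<and>
            real (card {A. A \<subseteq> P \<and> card A = r \<and>
                convex hull A \<inter> cball x (\<alpha> * diameter P) \<noteq> {}})
              \<ge> \<theta> * real (card P choose r)}.
          ereal \<alpha>)"

end

theory Submission
  imports Defs "HOL-Combinatorics.Permutations"
begin

text \<open>
  Index the coordinates by the subsets of a set of \<open>N\<close> points, and let the point \<open>i\<close> have
  coordinate 1 at the subsets containing \<open>i\<close> and 0 at the others. Two disjoint sets of points
  are then separated by a coordinate that is 1 on the hull of the first and 0 on the hull of the
  second, so a ball of radius less than 1/2 cannot meet both hulls. Hence the \<open>r\<close>-sets whose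
  hulls meet such a ball form an intersecting family, and by the Erdos-Ko-Rado theorem (proved
  by Katona's averaging over cyclic orders) they are at most a fraction \<open>r / N < \<theta>\<close> of all.
\<close>

section \<open>The Erdos-Ko-Rado theorem\<close>

text \<open>The symmetric group acts transitively on subsets of one size: a bijection from
  \<open>A\<close> to \<open>B\<close> is glued to one between the complements in \<open>S\<close>,
  which have equal size by finiteness.\<close>

lemma ex_permutes_image_eq:
  assumes "finite S" "A \<subseteq> S" "B \<subseteq> S" "card A = card B"
  obtains \<tau> where "\<tau> permutes S" "\<tau> ` A = B"
proof -
  have fin: "finite A" "finite B"
    using assms finite_subset by auto
  obtain f where f: "bij_betw f A B"
    using finite_same_card_bij [OF fin assms(4)] by blast
  have "card (S - A) = card (S - B)"
    using assms fin by (simp add: card_Diff_subset)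
  then obtain g where g: "bij_betw g (S - A) (S - B)"
    using finite_same_card_bij [of "S - A" "S - B"] assms(1) by auto
  define \<tau> where "\<tau> x = (if x \<in> A then f x else if x \<in> S then g x else x)" for x
  have 1: "bij_betw \<tau> A B"
    using f by (subst bij_betw_cong [where g = f]) (auto simp: \<tau>_def)
  have 2: "bij_betw \<tau> (S - A) (S - B)"
    using g by (subst bij_betw_cong [where g = g]) (auto simp: \<tau>_def)
  have "bij_betw \<tau> (A \<union> (S - A)) (B \<union> (S - B))"
    by (rule bij_betw_combine [OF 1 2]) auto
  then have "bij_betw \<tau> S S"
    using assms by (simp add: Un_absorb1)
  then have "\<tau> permutes S"
    using assms(2) by (intro bij_imp_permutes) (auto simp: \<tau>_def)
  moreover have "\<tau> ` A = B"
    using 1 by (simp add: bij_betw_def)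
  ultimately show ?thesis
    by (rule that)
qed

text \<open>The image of a fixed set under a random permutation is uniformly distributed.\<close>

lemma card_permutes_image_mem:
  assumes S: "finite S" and I: "I \<subseteq> S"
    and F: "F \<subseteq> {A. A \<subseteq> S \<and> card A = card I}"
  shows "card {\<sigma>. \<sigma> permutes S \<and> \<sigma> ` I \<in> F} * (card S choose card I) = card F * fact (card S)"
proof -
  define c where "c A = card {\<sigma>. \<sigma> permutes S \<and> \<sigma> ` I = A}" for A
  have finP: "finite {\<sigma>. \<sigma> permutes S}"
    using S by (rule finite_permutations)
  \<comment> \<open>Left composition with a permutation taking \<open>A\<close> to \<open>B\<close>
    injects the permutations counted by \<open>c A\<close> into those counted by \<open>c B\<close>;
    by symmetry \<open>c\<close> is constant.\<close>
  have le: "c A \<le> c B" if AB: "A \<subseteq> S" "B \<subseteq> S" "card A = card B" for A B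
  proof -
    obtain \<tau> where \<tau>: "\<tau> permutes S" "\<tau> ` A = B"
      using ex_permutes_image_eq [OF S AB] .
    show ?thesis
      unfolding c_def
    proof (rule card_inj_on_le)
      show "inj_on ((\<circ>) \<tau>) {\<sigma>. \<sigma> permutes S \<and> \<sigma> ` I = A}"
        using permutes_inj [OF \<tau>(1)] by (intro inj_onI ext) (metis comp_apply injD)
      show "(\<circ>) \<tau> ` {\<sigma>. \<sigma> permutes S \<and> \<sigma> ` I = A} \<subseteq> {\<sigma>. \<sigma> permutes S \<and> \<sigma> ` I = B}"
        using \<tau> by (auto simp: permutes_compose image_comp [symmetric])
      show "finite {\<sigma>. \<sigma> permutes S \<and> \<sigma> ` I = B}"
        using finP by (rule rev_finite_subset) auto
    qed
  qed
  have c: "c A = c I" if "A \<subseteq> S" "card A = card I" for A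
    using le [of A I] le [of I A] that I by simp
  have count: "card {\<sigma>. \<sigma> permutes S \<and> \<sigma> ` I \<in> G} = card G * c I"
    if G: "G \<subseteq> {A. A \<subseteq> S \<and> card A = card I}" for G
  proof -
    have finG: "finite G"
      using G S by (auto intro: finite_subset [of G "Pow S"])
    have "{\<sigma>. \<sigma> permutes S \<and> \<sigma> ` I \<in> G} = (\<Union>A\<in>G. {\<sigma>. \<sigma> permutes S \<and> \<sigma> ` I = A})"
      by auto
    then have "card {\<sigma>. \<sigma> permutes S \<and> \<sigma> ` I \<in> G} = (\<Sum>A\<in>G. c A)"
      unfolding c_def using finG
      by (auto intro!: card_UN_disjoint finite_subset [OF _ finP])
    also have "\<dots> = card G * c I"
      using G by (subst sum.cong [OF refl c]) auto
    finally show ?thesis .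
  qed
  \<comment> \<open>Taking all subsets of size \<open>card I\<close> as the family exhausts the
    permutations, which fixes the constant \<open>c I\<close>.\<close>
  have "{\<sigma>. \<sigma> permutes S \<and> \<sigma> ` I \<in> {A. A \<subseteq> S \<and> card A = card I}} = {\<sigma>. \<sigma> permutes S}"
    using I by (auto simp: permutes_image card_image permutes_inj_on dest: permutes_in_image)
  then have "fact (card S) = (card S choose card I) * c I"
    using count [OF order_refl] n_subsets [OF S] card_permutations [OF refl S] by simp
  then show ?thesis
    using count [OF F] by simp
qed

text \<open>
  Residues modulo \<open>r\<close> of offsets from a fixed element of \<open>J\<close> are distinct: equal residues
  belong to offsets that agree or differ by \<open>r\<close>, and the arcs starting at \<open>i\<close> and
  \<open>i + r\<close> are disjoint since \<open>2 * r \<le> n\<close>.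
\<close>

lemma card_intersecting_arcs_le:
  fixes n r :: int
  assumes "0 \<le> r" "2 * r \<le> n" and J: "J \<subseteq> {0..<n}"
    and meet: "\<And>i j. i \<in> J \<Longrightarrow> j \<in> J \<Longrightarrow> \<exists>t. \<bar>t\<bar> < r \<and> n dvd i - j - t"
  shows "card J \<le> nat r"
proof (cases "J = {}")
  case False
  then obtain j0 where j0: "j0 \<in> J"
    by blast
  then obtain t where t: "\<And>i. i \<in> J \<Longrightarrow> \<bar>t i\<bar> < r \<and> n dvd i - j0 - t i"
    using bchoice [of J "\<lambda>i t. \<bar>t\<bar> < r \<and> n dvd i - j0 - t"] meet by blast
  have t_dvd: "n dvd i - j0 - t i" if "i \<in> J" for i
    using t [OF that] by simp
  have "r > 0"
    using t [OF j0] by linarith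
  have no_shift: "t i - t j \<noteq> r" if ij: "i \<in> J" "j \<in> J" for i j
  proof
    assume eq: "t i - t j = r"
    obtain s where s: "\<bar>s\<bar> < r" "n dvd i - j - s"
      using meet ij by blast
    have "n dvd (i - j - s) - ((i - j0 - t i) - (j - j0 - t j))"
      by (intro dvd_diff [OF s(2)] dvd_diff [OF t_dvd t_dvd] ij)
    then have "n dvd r - s"
      using eq by (simp add: algebra_simps)
    moreover have "0 < r - s" "r - s < n"
      using s assms(2) by auto
    ultimately show False
      using zdvd_not_zless by blast
  qed
  have "inj_on (\<lambda>i. t i mod r) J"
  proof (rule inj_onI)
    fix i j assume ij: "i \<in> J" "j \<in> J" and "t i mod r = t j mod r"
    then have "r dvd t i - t j"
      by (simp add: mod_eq_dvd_iff)
    then obtain q where q: "t i - t j = r * q"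
      by (auto simp: dvd_def)
    \<comment> \<open>Both offsets lie strictly between \<open>- r\<close> and \<open>r\<close>, so
      their difference can only be 0, \<open>r\<close> or \<open>- r\<close>.\<close>
    have "\<bar>r * q\<bar> < r * 2"
      using t [OF ij(1)] t [OF ij(2)] q by linarith
    then have "\<bar>q\<bar> < 2"
      using \<open>r > 0\<close> by (simp add: abs_mult)
    then have "q = 0 \<or> q = 1 \<or> q = -1"
      by linarith
    then have "t i = t j"
      using q no_shift [OF ij] no_shift [OF ij(2) ij(1)] by auto
    moreover have "n dvd (i - j0 - t i) - (j - j0 - t j)"
      by (intro dvd_diff [OF t_dvd t_dvd] ij)
    ultimately have "n dvd i - j"
      by simp
    then have "i mod n = j mod n"
      by (simp add: mod_eq_dvd_iff)
    then show "i = j"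
      using ij J by (auto simp: subset_iff)
  qed
  then have "card J \<le> card {0..<r}"
    using \<open>r > 0\<close> by (intro card_inj_on_le) auto
  then show ?thesis
    by simp
qed simp

text \<open>Double counting of pairs of a permutation and a starting point whose arc is mapped into
  \<open>F\<close>: each permutation admits at most \<open>r\<close> starting points, while each
  starting point admits the fraction \<open>card F / (card S choose r)\<close> of all
  permutations.\<close>

theorem Erdos_Ko_Rado:
  assumes S: "finite S" and r: "2 * r \<le> card S"
    and F: "F \<subseteq> {A. A \<subseteq> S \<and> card A = r}"
    and meet: "\<And>A B. A \<in> F \<Longrightarrow> B \<in> F \<Longrightarrow> A \<inter> B \<noteq> {}"
  shows "card S * card F \<le> r * (card S choose r)"
proof -
  define n where "n = card S"
  obtain e0 where e0: "bij_betw e0 {0..<n} S"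
    using ex_bij_betw_nat_finite [OF S] n_def by blast
  define e where "e = (\<lambda>k. e0 (nat k))"
  have e: "bij_betw e {0..<int n} S"
  proof -
    have "bij_betw nat {0..<int n} {0..<n}"
      by (rule bij_betwI [where g = int]) auto
    from bij_betw_trans [OF this e0] show ?thesis
      by (simp add: e_def o_def)
  qed
  define arc where "arc i = (\<lambda>t. e ((i + t) mod int n)) ` {0..<int r}" for i
  have arc_sub: "arc i \<subseteq> S" for i
  \<comment> \<open>For positive \<open>r\<close> also \<open>n\<close> is positive, so residues
    modulo \<open>n\<close> stay in the domain of \<open>e\<close>; for \<open>r = 0\<close> the
    cycle may be empty, but so is the arc.\<close>
  proof (cases "r = 0")
    case False
    then show ?thesis
      using r bij_betwE [OF e] by (auto simp: arc_def n_def)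
  qed (simp add: arc_def)
  have card_arc: "card (arc i) = r" for i
  proof -
    have "inj_on (\<lambda>t. e ((i + t) mod int n)) {0..<int r}"
    proof (rule inj_onI)
      fix t u assume tu: "t \<in> {0..<int r}" "u \<in> {0..<int r}"
        and eq: "e ((i + t) mod int n) = e ((i + u) mod int n)"
      have rn: "0 < int n" "int r < int n"
        using tu r by (auto simp: n_def)
      then have "(i + t) mod int n = (i + u) mod int n"
        using eq bij_betw_imp_inj_on [OF e] by (auto dest!: inj_onD)
      then have "((i + t) - i) mod int n = ((i + u) - i) mod int n"
        by (metis mod_diff_left_eq)
      then show "t = u"
        using tu rn by simp
    qed
    then show ?thesis
      by (simp add: arc_def card_image)
  qed
  define Q where "Q = {\<sigma>. \<sigma> permutes S}"
  have finQ: "finite Q"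
    using S by (simp add: Q_def finite_permutations)
  have cardQ: "card Q = fact n"
    using S by (simp add: Q_def n_def card_permutations)
  have cyclic: "card {i \<in> {0..<int n}. \<sigma> ` arc i \<in> F} \<le> r" if "\<sigma> \<in> Q" for \<sigma>
  proof -
    have inj: "inj \<sigma>"
      using that by (simp add: Q_def permutes_inj)
    have "card {i \<in> {0..<int n}. \<sigma> ` arc i \<in> F} \<le> nat (int r)"
    proof (rule card_intersecting_arcs_le)
      fix i j assume "i \<in> {i \<in> {0..<int n}. \<sigma> ` arc i \<in> F}" "j \<in> {i \<in> {0..<int n}. \<sigma> ` arc i \<in> F}"
      then have "\<sigma> ` arc i \<inter> \<sigma> ` arc j \<noteq> {}" and n: "int n > 0"
        using meet by auto
      then have "arc i \<inter> arc j \<noteq> {}"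
        using inj by (auto simp: inj_def)
      then obtain t u where tu: "t \<in> {0..<int r}" "u \<in> {0..<int r}"
        and eq: "e ((i + t) mod int n) = e ((j + u) mod int n)"
        unfolding arc_def by blast
      have "(i + t) mod int n = (j + u) mod int n"
        using eq bij_betw_imp_inj_on [OF e] n by (auto dest!: inj_onD)
      then have "int n dvd i - j - (u - t)"
        by (simp add: mod_eq_dvd_iff algebra_simps)
      then show "\<exists>t. \<bar>t\<bar> < int r \<and> int n dvd i - j - t"
        using tu by (intro exI [of _ "u - t"]) auto
    qed (use r in \<open>auto simp: n_def\<close>)
    then show ?thesis
      by simp
  qed
  have arcs: "card {\<sigma> \<in> Q. \<sigma> ` arc i \<in> F} * (n choose r) = card F * fact n" for i
    using card_permutes_image_mem [OF S arc_sub, of F i] F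
    by (simp add: card_arc Q_def n_def)
  have "(\<Sum>i\<in>{0..<int n}. card {\<sigma> \<in> Q. \<sigma> ` arc i \<in> F})
      = (\<Sum>\<sigma>\<in>Q. card {i \<in> {0..<int n}. \<sigma> ` arc i \<in> F})"
    using finQ by (intro sum_multicount_gen) auto
  also have "\<dots> \<le> (\<Sum>\<sigma>\<in>Q. r)"
    by (rule sum_mono) (rule cyclic)
  finally have "(\<Sum>i\<in>{0..<int n}. card {\<sigma> \<in> Q. \<sigma> ` arc i \<in> F}) \<le> fact n * r"
    by (simp add: cardQ)
  \<comment> \<open>The extra factor turns every summand into \<open>card F * fact n\<close> by
    \<open>arcs\<close>, so that \<open>fact n\<close> cancels without any division.\<close>
  then have "(\<Sum>i\<in>{0..<int n}. card {\<sigma> \<in> Q. \<sigma> ` arc i \<in> F}) * (n choose r) \<le> fact n * r * (n choose r)"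
    by (rule mult_le_mono1)
  then have "fact n * (n * card F) \<le> fact n * (r * (n choose r))"
    by (simp only: sum_distrib_right arcs) (simp only: sum_constant card_atLeastLessThan_int diff_zero nat_int of_nat_id ac_simps)
  then show ?thesis
    by (simp add: n_def)
qed

section \<open>Cube vertices in the maximum norm\<close>

lemma component_le_norm_linf: "\<bar>vec_of_linf x $ i\<bar> \<le> norm x"
  by (simp add: norm_linf_eq_Max)

lemma convex_hull_component_linf:
  assumes "\<And>a. a \<in> A \<Longrightarrow> vec_of_linf a $ s = c" "y \<in> convex hull A"
  shows "vec_of_linf y $ s = c"
proof -
  have "convex {y. vec_of_linf y $ s = c}"
    by (auto simp: convex_def simp flip: distrib_right)
  then have "convex hull A \<subseteq> {y. vec_of_linf y $ s = c}"
    using assms(1) by (intro hull_minimal) auto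
  then show ?thesis
    using assms(2) by auto
qed

text \<open>Points of the two hulls in the ball differ by 1 in coordinate \<open>s\<close>, and both
  are within \<open>\<rho>\<close> of the centre there, so 1 is at most twice
  \<open>\<rho>\<close>.\<close>

lemma separated_hulls_cball_linf:
  assumes "\<And>a. a \<in> A \<Longrightarrow> vec_of_linf a $ s = 1" "\<And>b. b \<in> B \<Longrightarrow> vec_of_linf b $ s = 0"
    and "convex hull A \<inter> cball x \<rho> \<noteq> {}" "convex hull B \<inter> cball x \<rho> \<noteq> {}"
  shows "1 / 2 \<le> \<rho>"
proof -
  obtain y z where y: "y \<in> convex hull A" "dist x y \<le> \<rho>" and z: "z \<in> convex hull B" "dist x z \<le> \<rho>"
    using assms(3,4) by auto
  have "vec_of_linf y $ s = 1" "vec_of_linf z $ s = 0"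
    using convex_hull_component_linf assms y z by blast+
  moreover have "\<bar>vec_of_linf (x - y) $ s\<bar> \<le> \<rho>" "\<bar>vec_of_linf (x - z) $ s\<bar> \<le> \<rho>"
    using component_le_norm_linf order_trans y z by (metis dist_norm)+
  ultimately show ?thesis
    by simp
qed

lemma ex_separating_points_linf:
  assumes "CARD('m::finite) = 2 ^ N" "N \<ge> 2"
  obtains P :: "('m::finite) linf set" where "finite P" "card P = N" "diameter P = 1"
    "\<And>A. A \<subseteq> P \<Longrightarrow> \<exists>s. \<forall>p\<in>P. vec_of_linf p $ s = (if p \<in> A then 1 else 0)"
proof -
  have "card (UNIV :: 'm set) = card (Pow {..<N})"
    using assms by (simp add: card_Pow)
  then obtain g where g: "bij_betw g (UNIV :: 'm set) (Pow {..<N})"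
    using finite_same_card_bij [of "UNIV :: 'm set" "Pow {..<N}"] by auto
  define p :: "nat \<Rightarrow> 'm linf" where
    "p i = linf_of_vec (\<chi> s. if i \<in> g s then 1 else 0)" for i
  have p: "vec_of_linf (p i) $ s = (if i \<in> g s then 1 else 0)" for i s
    by (simp add: p_def)
  have g_surj: "\<exists>s. g s = T" if "T \<subseteq> {..<N}" for T
    using g that by (metis PowI bij_betw_imp_surj_on imageE)
  have dist_ge: "dist (p i) (p j) \<ge> 1" if ij: "i < N" "i \<noteq> j" for i j
  proof -
    \<comment> \<open>The coordinate labelled by the singleton is 1 at \<open>p i\<close> and 0 at
      \<open>p j\<close>.\<close>
    obtain s where "g s = {i}"
      using g_surj [of "{i}"] ij by auto
    then show ?thesis
      using component_le_norm_linf [of "p i - p j" s] ij by (simp add: p dist_norm)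
  qed
  have dist_le: "dist (p i) (p j) \<le> 1" for i j
    by (simp add: dist_norm norm_linf_eq_Max p)
  have inj: "inj_on p {..<N}"
    using dist_ge by (metis dist_self inj_onI lessThan_iff not_one_le_zero)
  define P where "P = p ` {..<N}"
  show ?thesis
  proof
    show fin: "finite P" and "card P = N"
      using inj by (simp_all add: P_def card_image)
    show "diameter P = 1"
    proof (rule antisym)
      show "diameter P \<le> 1"
        using dist_le by (intro diameter_le) (auto simp: P_def simp flip: dist_norm)
      have "dist (p 0) (p 1) \<le> diameter P"
        using fin assms(2) by (intro diameter_bounded_bound finite_imp_bounded) (auto simp: P_def)
      then show "1 \<le> diameter P"
        using dist_ge [of 0 1] assms(2) by simp
    qed
    fix A assume "A \<subseteq> P"
    obtain s where "g s = {i. i < N \<and> p i \<in> A}"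
      using g_surj [of "{i. i < N \<and> p i \<in> A}"] by auto
    then show "\<exists>s. \<forall>p\<in>P. vec_of_linf p $ s = (if p \<in> A then 1 else 0)"
      by (intro exI [of _ s]) (auto simp: P_def p)
  qed
qed

section \<open>Lower bound for the selection constant\<close>

lemma Sel_geI:
  fixes P :: "'a::banach set"
  assumes "finite P" "card P \<ge> r" "diameter P > 0"
    and "\<And>x \<alpha>. \<alpha> > 0 \<Longrightarrow>
      real (card {A. A \<subseteq> P \<and> card A = r \<and> convex hull A \<inter> cball x (\<alpha> * diameter P) \<noteq> {}})
        \<ge> \<theta> * real (card P choose r) \<Longrightarrow> c \<le> \<alpha>"
  shows "ereal c \<le> Sel TYPE('a) r \<theta>"
  unfolding Sel_def using assms by (intro SUP_upper2 [of P] INF_greatest) auto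

theorem lemma10p5:
  fixes r N :: nat and \<theta> :: real
  assumes "0 < \<theta>" and "\<theta> < 1"
    and "N \<ge> 2 * r" and "real r / real N < \<theta>"
    and "CARD('m::finite) = 2 ^ N"
  shows "Sel TYPE('m linf) r \<theta> \<ge> 1 / 2"
proof -
  have "ereal (1 / 2) \<le> Sel TYPE('m linf) r \<theta>"
  proof (cases "r = 0")
    \<comment> \<open>Here \<open>N\<close> may be too small for the cube points to have positive
      diameter, but any two-point set works: the only 0-subset is empty, its hull meets no ball, and
      the count 0 is below \<open>\<theta>\<close>, so no \<open>\<alpha>\<close> is
      admissible.\<close>
    case True
    define u :: "'m linf" where "u = linf_of_vec 1"
    have "u \<noteq> 0"
      by (simp add: u_def flip: vec_of_linf_inject)
    moreover have "dist u 0 \<le> diameter {u, 0}"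
      by (intro diameter_bounded_bound finite_imp_bounded) auto
    ultimately have "diameter {u, 0} > 0"
      by (smt (verit) zero_less_dist_iff)
    then show ?thesis
    proof (rule Sel_geI [rotated 2])
      fix x \<alpha>
      have empty: "{A. A \<subseteq> {u, 0} \<and> card A = r \<and> convex hull A \<inter> cball x (\<alpha> * diameter {u, 0}) \<noteq> {}} = {}"
        using True by (auto simp: card_eq_0_iff dest: finite_subset)
      assume "real (card {A. A \<subseteq> {u, 0} \<and> card A = r \<and> convex hull A \<inter> cball x (\<alpha> * diameter {u, 0}) \<noteq> {}})
          \<ge> \<theta> * real (card {u, 0} choose r)"
      then show "1 / 2 \<le> \<alpha>"
        unfolding empty using True assms(1) by simp
    qed (use True in auto)
  next
    case False
    then have N: "N \<ge> 2" "N \<ge> r"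
      using assms(3) by auto
    obtain P :: "'m linf set" where P: "finite P" "card P = N" "diameter P = 1"
      and sep: "\<And>A. A \<subseteq> P \<Longrightarrow> \<exists>s. \<forall>p\<in>P. vec_of_linf p $ s = (if p \<in> A then 1 else 0)"
      using ex_separating_points_linf [OF assms(5) N(1)] by blast
    show ?thesis
    proof (rule Sel_geI [of P])
      fix x \<alpha>
      define F where "F = {A. A \<subseteq> P \<and> card A = r \<and> convex hull A \<inter> cball x (\<alpha> * diameter P) \<noteq> {}}"
      assume "real (card {A. A \<subseteq> P \<and> card A = r \<and> convex hull A \<inter> cball x (\<alpha> * diameter P) \<noteq> {}})
          \<ge> \<theta> * real (card P choose r)"
      then have large: "\<theta> * real (N choose r) \<le> real (card F)"
        by (simp add: F_def P)
      show "1 / 2 \<le> \<alpha>"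
      proof (rule ccontr)
        assume "\<not> 1 / 2 \<le> \<alpha>"
        then have \<alpha>: "\<alpha> < 1 / 2"
          by simp
        have "card P * card F \<le> r * (card P choose r)"
        proof (rule Erdos_Ko_Rado)
          fix A B assume AB: "A \<in> F" "B \<in> F"
          show "A \<inter> B \<noteq> {}"
          proof
            assume disj: "A \<inter> B = {}"
            have sub: "A \<subseteq> P" "B \<subseteq> P"
              using AB by (simp_all add: F_def)
            \<comment> \<open>This coordinate is 1 on \<open>A\<close> and 0 on the rest of
              \<open>P\<close>, hence on \<open>B\<close>; as \<open>P\<close> has diameter 1, the
              ball has radius \<open>\<alpha>\<close>.\<close>
            obtain s where s: "\<forall>p\<in>P. vec_of_linf p $ s = (if p \<in> A then 1 else 0)"
              using sep [OF sub(1)] by blast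
            have "1 / 2 \<le> \<alpha>"
            proof (rule separated_hulls_cball_linf)
              show "vec_of_linf a $ s = 1" if "a \<in> A" for a
                using s that sub by auto
              show "vec_of_linf b $ s = 0" if "b \<in> B" for b
                using s that sub disj by (simp add: subset_iff disjoint_iff) blast
            qed (use AB P in \<open>auto simp: F_def\<close>)
            then show False
              using \<alpha> by simp
          qed
        qed (use P assms(3) in \<open>auto simp: F_def\<close>)
        then have "real N * real (card F) \<le> real r * real (N choose r)"
          using P by (simp flip: of_nat_mult)
        then have "real (card F) \<le> real r / real N * real (N choose r)"
          using N by (simp add: field_simps)
        \<comment> \<open>Strictness needs a positive binomial coefficient, which
          \<open>r \<le> N\<close> gives.\<close>
        also have "\<dots> < \<theta> * real (N choose r)"
          using assms(4) N by (intro mult_strict_right_mono) auto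
        finally show False
          using large by simp
      qed
    qed (use P N in auto)
  qed
  then show ?thesis
    by (simp add: ereal_divide one_ereal_def)
qed

end
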